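(* Consider the \textsc{Threshold}-$v$ problem in the noisy value model. There is no instance-optimal algorithm (with respect to query complexity) for \textsc{Threshold}-$v$ on the class of inputs whose number of distinct values is $\Omega(n)$.
   Context: \textsc{Threshold}-$v$ problem: given $n$ elements carrying values and a threshold $v$, output exactly the elements whose value is at least $v$. Noisy value model: a query about element $i$ returns its true value with probability $2/3$ and an arbitrary (adversarial) value otherwise. Let $\mathcal{A}$ be the set of algorithms that are correct with probability at least $2/3$ on every input. An algorithm $B$ is instance-optimal on a class of inputs $\mathcal{I}$ if for every input $J\in\mathcal{I}$ it is correct with probability at least $2/3$ and its expected query complexity on $J$ is $O\left(\inf_{A\in\mathcal{A}}\sup_{I\text{ permutation of }J}(\text{expected query complexity of }A\text{ on }I)\right)$, where the constant in $O(\cdot)$ does not depend on $J$. An algorithm has no prior knowledge of the multiset of input values. *)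

theory Defs
  imports "HOL-Probability.Probability"
begin

text \<open>An input with \<open>n\<close> elements is a list of length \<open>n\<close>; element \<open>i < n\<close> has value \<open>xs ! i\<close>.
  A transcript lists the queries made so far, oldest first, with the answers received.\<close>

type_synonym transcript = "(nat \<times> real) list"

datatype action = Query nat | Output "nat set"

text \<open>An algorithm is an adaptive randomized strategy: from the number of elements and the
  transcript, it draws its next action. Drawing fresh randomness at every step is no restriction.
  The adversary chooses each wrong answer from the transcript and the element being queried; as it
  is quantified after the algorithm and the input, it may depend on both.\<close>

type_synonym algorithm = "nat \<Rightarrow> transcript \<Rightarrow> action pmf"
type_synonym adversary = "transcript \<Rightarrow> nat \<Rightarrow> real"

definition valid_algorithm :: "algorithm \<Rightarrow> bool" where
  "valid_algorithm A \<longleftrightarrow> (\<forall>n h i. Query i \<in> set_pmf (A n h) \<longrightarrow> i < n)"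

definition noisy_answer :: "real list \<Rightarrow> adversary \<Rightarrow> transcript \<Rightarrow> nat \<Rightarrow> real pmf" where
  "noisy_answer xs adv h i =
     map_pmf (\<lambda>truthful. if truthful then xs ! i else adv h i) (bernoulli_pmf (2/3))"

text \<open>A configuration consists of the transcript and, once the algorithm has halted, its output.\<close>

type_synonym config = "transcript \<times> nat set option"

definition step :: "algorithm \<Rightarrow> real list \<Rightarrow> adversary \<Rightarrow> config \<Rightarrow> config pmf" where
  "step A xs adv = (\<lambda>(h, out). case out of
       Some S \<Rightarrow> return_pmf (h, Some S)
     | None \<Rightarrow> bind_pmf (A (length xs) h) (\<lambda>a. case a of
           Output S \<Rightarrow> return_pmf (h, Some S)
         | Query i \<Rightarrow> map_pmf (\<lambda>y. (h @ [(i, y)], None)) (noisy_answer xs adv h i)))"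

primrec run :: "algorithm \<Rightarrow> real list \<Rightarrow> adversary \<Rightarrow> nat \<Rightarrow> config pmf" where
  "run A xs adv 0 = return_pmf ([], None)"
| "run A xs adv (Suc t) = bind_pmf (run A xs adv t) (step A xs adv)"

definition threshold_set :: "real \<Rightarrow> real list \<Rightarrow> nat set" where
  "threshold_set v xs = {i. i < length xs \<and> v \<le> xs ! i}"

text \<open>Both suprema over the number \<open>t\<close> of steps are limits of sequences that increase with \<open>t\<close>.
  A run that never halts is not successful and makes infinitely many queries.\<close>

definition success_prob :: "real \<Rightarrow> algorithm \<Rightarrow> real list \<Rightarrow> adversary \<Rightarrow> real" where
  "success_prob v A xs adv =
     (SUP t. measure_pmf.prob (run A xs adv t) {s. snd s = Some (threshold_set v xs)})"

definition expected_queries :: "algorithm \<Rightarrow> real list \<Rightarrow> adversary \<Rightarrow> ennreal" where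
  "expected_queries A xs adv =
     (SUP t. \<integral>\<^sup>+ s. of_nat (length (fst s)) \<partial>measure_pmf (run A xs adv t))"

definition correct_on :: "real \<Rightarrow> algorithm \<Rightarrow> real list \<Rightarrow> bool" where
  "correct_on v A xs \<longleftrightarrow> (\<forall>adv. success_prob v A xs adv \<ge> 2/3)"

definition query_complexity :: "algorithm \<Rightarrow> real list \<Rightarrow> ennreal" where
  "query_complexity A xs = (SUP adv. expected_queries A xs adv)"

definition correct_algorithms :: "real \<Rightarrow> algorithm set" where
  "correct_algorithms v = {A. valid_algorithm A \<and> (\<forall>xs. correct_on v A xs)}"

definition instance_complexity :: "real \<Rightarrow> real list \<Rightarrow> ennreal" where
  "instance_complexity v J =
     (INF A \<in> correct_algorithms v. SUP I \<in> {I. mset I = mset J}. query_complexity A I)"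

definition instance_optimal :: "real \<Rightarrow> real list set \<Rightarrow> algorithm \<Rightarrow> bool" where
  "instance_optimal v \<I> B \<longleftrightarrow> valid_algorithm B \<and> (\<forall>J\<in>\<I>. correct_on v B J) \<and>
     (\<exists>C::real. \<forall>J\<in>\<I>. query_complexity B J \<le> ennreal C * instance_complexity v J)"

definition many_distinct_values :: "real \<Rightarrow> real list set" where
  "many_distinct_values c = {xs. real (card (set xs)) \<ge> c * real (length xs)}"

end

theory Submission
  imports Defs
begin

text \<open>Fix \<open>n\<close> pairs of a value below \<open>v\<close> and a value at least \<open>v\<close>, with all \<open>2 * n\<close> values distinct.
  Give element \<open>i\<close> one of the two values of the \<open>i\<close>-th pair and let the adversary lie with the other.
  Adding \<open>i\<close> to the set \<open>S\<close> of large elements decreases the probability of a transcript with \<open>q\<close>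
  queries of \<open>i\<close> at most by the factor \<open>2 ^ q\<close>. As an input with \<open>k + 1\<close> large elements has \<open>k + 1\<close>
  neighbours with \<open>k\<close> large elements, whose outputs exclude each other, most elements must be queried
  about \<open>log k\<close> times for some \<open>S\<close> of size \<open>k\<close>.

  If \<open>k = sqrt n\<close>, an algorithm that knows the values gets by with any given fraction of that. It
  takes the majority of a constant number of answers as the claim of each element and spends
  \<open>O(log n)\<close> further queries only on elements that claim a value that is large, unknown or claimed
  twice. Pass from a large element with a small claim to the owner of the value that it claims, from
  there to the owner of the value that this one claims, and so on: the chain ends with an element to
  be examined, whose corrected claim is then claimed twice, so the examination travels back along the
  chain and finds the large element. The number of examined elements is at
  most \<open>k\<close> plus twice the number of wrong first claims, a small constant fraction of \<open>n\<close>.\<close>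

section \<open>Answers and majorities\<close>

definition answers :: "nat \<Rightarrow> transcript \<Rightarrow> real list" where
  "answers i h = map snd (filter (\<lambda>p. fst p = i) h)"

lemma answers_Nil [simp]: "answers i [] = []"
  by (simp add: answers_def)

lemma answers_snoc [simp]:
  "answers i (h @ [(j, y)]) = (if j = i then answers i h @ [y] else answers i h)"
  by (simp add: answers_def)

lemma sum_length_answers_le:
  assumes "finite I"
  shows "(\<Sum>i\<in>I. length (answers i h)) \<le> length h"
proof (induction h rule: rev_induct)
  case (snoc p h)
  obtain j y where p: "p = (j, y)" by force
  have "(\<Sum>i\<in>I. length (answers i (h @ [p])))
      = (\<Sum>i\<in>I. length (answers i h) + (if j = i then 1 else 0))"
    by (rule sum.cong) (auto simp: p)
  also have "\<dots> = (\<Sum>i\<in>I. length (answers i h)) + (if j \<in> I then 1 else 0)"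
    using assms by (simp add: sum.distrib)
  also have "\<dots> \<le> length h + 1" using snoc by simp
  finally show ?case by simp
qed simp

lemma length_eq_sum_answers:
  assumes "fst ` set h \<subseteq> {..<n}"
  shows "length h = (\<Sum>i<n. length (answers i h))"
  using assms
proof (induction h rule: rev_induct)
  case (snoc p h)
  obtain j y where p: "p = (j, y)" by force
  have j: "j < n" using snoc.prems p by auto
  have "(\<Sum>i<n. length (answers i (h @ [p])))
      = (\<Sum>i<n. length (answers i h) + (if j = i then 1 else 0))"
    by (rule sum.cong) (auto simp: p)
  also have "\<dots> = (\<Sum>i<n. length (answers i h)) + 1"
    using j by (simp add: sum.distrib)
  also have "(\<Sum>i<n. length (answers i h)) = length h"
    using snoc by simp
  finally show ?case by simp
qed simp

text \<open>Two values cannot both fill more than half of the list, so \<open>THE\<close> is well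
  defined; a tie yields the default \<open>d\<close>.\<close>

definition majority :: "real \<Rightarrow> real list \<Rightarrow> real" where
  "majority d l = (if \<exists>y. length l < 2 * count_list l y
     then THE y. length l < 2 * count_list l y else d)"

lemma count_list_add_le_length: "y \<noteq> z \<Longrightarrow> count_list l y + count_list l z \<le> length l"
  by (induction l) auto

lemma majority_eqI:
  assumes "length l < 2 * count_list l y"
  shows "majority d l = y"
proof -
  have "z = y" if "length l < 2 * count_list l z" for z
    using count_list_add_le_length[of y z l] assms that by (cases "z = y") auto
  then have "(THE y. length l < 2 * count_list l y) = y"
    using assms by (intro the_equality) blast+
  moreover have "\<exists>y. length l < 2 * count_list l y" using assms by blast
  ultimately show ?thesis unfolding majority_def by presburger
qed

text \<open>If every answer is right with probability at least \<open>2/3\<close>, appending an answer does not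
  increase this weight on average, as \<open>2/3 * 3/4 + 1/3 * 3/2 = 1\<close>.\<close>

definition weight :: "real \<Rightarrow> real list \<Rightarrow> real" where
  "weight x l = prod_list (map (\<lambda>y. if y = x then 3/4 else 3/2) l)"

lemma weight_Nil [simp]: "weight x [] = 1"
  by (simp add: weight_def)

lemma weight_snoc [simp]:
  "weight x (l @ [y]) = weight x l * (if y = x then 3/4 else 3/2)"
  by (simp add: weight_def)

lemma weight_nonneg [simp]: "0 \<le> weight x l"
  by (induction l) (auto simp: weight_def)

lemma weight_eq: "weight x l = (3/4) ^ count_list l x * (3/2) ^ (length l - count_list l x)"
proof (induction l)
  case (Cons y l)
  have "count_list l x \<le> length l" by (rule count_le_length)
  then show ?case using Cons by (simp add: weight_def Suc_diff_le)
qed (simp add: weight_def)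

text \<open>At most half of the answers are \<open>x\<close>. Each of these pairs with another
  answer to the weight \<open>3/4 * 3/2 = 9/8\<close>, and every pair of remaining answers weighs
  \<open>9/4\<close>.\<close>

lemma weight_ge_if_majority_wrong:
  assumes len: "length l = 2 * p" and wrong: "majority d l \<noteq> x"
  shows "(9/8) ^ p \<le> weight x l"
proof -
  define c where "c = count_list l x"
  have c: "c \<le> p" using majority_eqI[of l x d] wrong len by (fastforce simp: c_def)
  then obtain e where e: "p = c + e" using le_Suc_ex by blast
  have "weight x l = (3/4) ^ c * (3/2) ^ (c + 2 * e)"
    using len by (simp add: weight_eq c_def[symmetric] e)
  also have "\<dots> = (9/8) ^ c * (9/4) ^ e"
  proof -
    have "(3/2 :: real) ^ (c + 2 * e) = (3/2) ^ c * (9/4) ^ e"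
      by (simp add: power_add power_mult power2_eq_square)
    moreover have "(3/4 :: real) ^ c * (3/2) ^ c = (9/8) ^ c"
      by (simp flip: power_mult_distrib)
    ultimately show ?thesis by simp
  qed
  also have "\<dots> \<ge> (9/8) ^ c * (9/8) ^ e"
    by (intro mult_left_mono power_mono) auto
  finally show ?thesis by (simp add: e power_add)
qed

section \<open>Expectations along a run\<close>

lemma nn_integral_step_Some: "(\<integral>\<^sup>+ s. f s \<partial>step A xs adv (h, Some S)) = f (h, Some S)"
  by (simp add: step_def)

lemma nn_integral_step_None:
  "(\<integral>\<^sup>+ s. f s \<partial>step A xs adv (h, None)) =
   (\<integral>\<^sup>+ a. (case a of Output S \<Rightarrow> f (h, Some S)
      | Query i \<Rightarrow> ennreal (2/3) * f (h @ [(i, xs ! i)], None)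
                 + ennreal (1/3) * f (h @ [(i, adv h i)], None)) \<partial>A (length xs) h)"
  unfolding step_def noisy_answer_def
  by (auto simp: nn_integral_bind_pmf intro!: nn_integral_cong split: action.split)
     (auto simp: map_pmf_comp mult.commute)

text \<open>The supermartingale bound. It involves no independence, so it also covers adaptive
  algorithms and adversaries.\<close>

lemma nn_integral_run_le:
  assumes "\<And>c. (\<integral>\<^sup>+ s. f s \<partial>step A xs adv c) \<le> f c"
  shows "(\<integral>\<^sup>+ s. f s \<partial>run A xs adv t) \<le> f ([], None)"
proof (induction t)
  case (Suc t)
  have "(\<integral>\<^sup>+ s. f s \<partial>run A xs adv (Suc t)) \<le> (\<integral>\<^sup>+ s. f s \<partial>run A xs adv t)"
    using assms by (simp add: nn_integral_bind_pmf nn_integral_mono)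
  then show ?case using Suc by simp
qed simp

text \<open>Cutting off after \<open>q\<close> answers stops the supermartingale, whatever number of
  answers the algorithm goes on to collect.\<close>

lemma nn_integral_weight_run_le:
  "(\<integral>\<^sup>+ s. ennreal (weight (xs ! i) (take q (answers i (fst s)))) \<partial>run A xs adv t) \<le> 1"
proof -
  let ?f = "\<lambda>s :: config. ennreal (weight (xs ! i) (take q (answers i (fst s))))"
  have "(\<integral>\<^sup>+ s. ?f s \<partial>step A xs adv c) \<le> ?f c" for c
  proof (cases c)
    case (Pair h out)
    show ?thesis
    proof (cases out)
      case None
      have "(case a of Output S \<Rightarrow> ?f (h, Some S)
          | Query j \<Rightarrow> ennreal (2/3) * ?f (h @ [(j, xs ! j)], None)
               + ennreal (1/3) * ?f (h @ [(j, adv h j)], None)) \<le> ?f (h, None)" for a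
      proof (cases a)
        case (Query j)
        let ?w = "\<lambda>y. weight (xs ! i) (take q (answers i (h @ [(j, y)])))"
        let ?u = "weight (xs ! i) (take q (answers i h))"
        have "2/3 * ?w (xs ! j) + 1/3 * ?w (adv h j) \<le> ?u"
        \<comment> \<open>Only a query of \<open>i\<close> that still enters the prefix changes it;
          a lie that happens to equal \<open>xs ! i\<close> weighs even less.\<close>
        proof (cases "j = i \<and> length (answers i h) < q")
          case True
          then have "take q (answers i (h @ [(j, y)])) = answers i h @ [y]"
            and "take q (answers i h) = answers i h" for y by auto
          then show ?thesis using True weight_nonneg[of "xs ! i" "answers i h"]
            by (simp only: weight_snoc) auto
        qed auto
        then have "ennreal (2/3 * ?w (xs ! j) + 1/3 * ?w (adv h j)) \<le> ennreal ?u"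
          by (rule ennreal_leI)
        then show ?thesis using Query
          by (simp only: action.case ennreal_plus ennreal_mult weight_nonneg mult_nonneg_nonneg
              fst_conv zero_le_divide_1_iff zero_le_numeral divide_nonneg_nonneg)
      qed simp
      then have "(\<integral>\<^sup>+ s. ?f s \<partial>step A xs adv (h, None)) \<le> (\<integral>\<^sup>+ a. ?f (h, None) \<partial>A (length xs) h)"
        unfolding nn_integral_step_None by (intro nn_integral_mono) blast
      then show ?thesis using Pair None by simp
    qed (simp add: Pair nn_integral_step_Some)
  qed
  then have "(\<integral>\<^sup>+ s. ?f s \<partial>run A xs adv t) \<le> ?f ([], None)"
    by (rule nn_integral_run_le[where f = ?f])
  then show ?thesis by simp
qed

text \<open>The answer \<open>y\<close> is unconstrained, so such invariants hold against every
  adversary.\<close>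

lemma run_invariant:
  assumes "P [] None"
    and "\<And>h S. P h None \<Longrightarrow> Output S \<in> set_pmf (A (length xs) h) \<Longrightarrow> P h (Some S)"
    and "\<And>h i y. P h None \<Longrightarrow> Query i \<in> set_pmf (A (length xs) h) \<Longrightarrow> P (h @ [(i, y)]) None"
    and "s \<in> set_pmf (run A xs adv t)"
  shows "P (fst s) (snd s)"
  using assms(4)
proof (induction t arbitrary: s)
  case (Suc t)
  then obtain c where c: "c \<in> set_pmf (run A xs adv t)" "s \<in> set_pmf (step A xs adv c)" by auto
  obtain h out where ho: "c = (h, out)" by force
  have P: "P h out" using Suc.IH[OF c(1)] ho by simp
  show ?case
  proof (cases out)
    case None
    then obtain a where a: "a \<in> set_pmf (A (length xs) h)" and
      s: "s \<in> set_pmf (case a of Output S \<Rightarrow> return_pmf (h, Some S)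
         | Query i \<Rightarrow> map_pmf (\<lambda>y. (h @ [(i, y)], None)) (noisy_answer xs adv h i))"
      using c(2) ho by (auto simp: step_def)
    show ?thesis using a s P None assms(2,3) by (cases a) auto
  qed (use c(2) P ho in \<open>auto simp: step_def\<close>)
qed (use assms(1) in simp)

lemma run_None_length:
  assumes "s \<in> set_pmf (run A xs adv t)" "snd s = None"
  shows "length (fst s) = t"
  using assms
proof (induction t arbitrary: s)
  case (Suc t)
  then obtain c where c: "c \<in> set_pmf (run A xs adv t)" "s \<in> set_pmf (step A xs adv c)" by auto
  obtain h out where ho: "c = (h, out)" by force
  show ?case
  proof (cases out)
    case None
    then obtain a where
      s: "s \<in> set_pmf (case a of Output S \<Rightarrow> return_pmf (h, Some S)
         | Query i \<Rightarrow> map_pmf (\<lambda>y. (h @ [(i, y)], None)) (noisy_answer xs adv h i))"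
      using c(2) ho by (auto simp: step_def)
    have "length h = t" using Suc.IH[OF c(1)] ho None by simp
    then show ?thesis using s Suc.prems(2) by (cases a) auto
  qed (use c(2) ho Suc.prems in \<open>auto simp: step_def\<close>)
qed simp

text \<open>The verdict on an element is fixed once it has \<open>q\<close> answers, so this set
  only grows along a run.\<close>

definition wrong :: "real \<Rightarrow> real list \<Rightarrow> nat \<Rightarrow> transcript \<Rightarrow> nat set" where
  "wrong d xs q h =
     {i. i < length xs \<and> q \<le> length (answers i h) \<and> majority d (take q (answers i h)) \<noteq> xs ! i}"

lemma finite_wrong [simp]: "finite (wrong d xs q h)"
  by (simp add: wrong_def)

lemma take_answers_snoc:
  "q \<le> length (answers j h) \<Longrightarrow> take q (answers j (h @ [(i, y)])) = take q (answers j h)"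
  by simp

lemma wrong_snoc_mono: "wrong d xs q h \<subseteq> wrong d xs q (h @ [(i, y)])"
  by (auto simp: wrong_def)

text \<open>Markov's inequality: a wrong majority forces the weight, whose expectation is at most 1,
  up to \<open>(9/8) ^ p\<close>.\<close>

lemma prob_wrong_le:
  "measure_pmf.prob (run A xs adv t) {s. i \<in> wrong d xs (2 * p) (fst s)} \<le> (8/9) ^ p"
proof -
  let ?w = "\<lambda>s :: config. weight (xs ! i) (take (2 * p) (answers i (fst s)))"
  let ?B = "{s :: config. i \<in> wrong d xs (2 * p) (fst s)}"
  have "indicator ?B s \<le> ennreal ((8/9) ^ p) * ennreal (?w s)" for s :: config
  proof (cases "s \<in> ?B")
    case True
    then have "(9/8) ^ p \<le> ?w s"
      by (intro weight_ge_if_majority_wrong[where d = d]) (auto simp: wrong_def)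
    then have "(8/9) ^ p * (9/8) ^ p \<le> (8/9) ^ p * ?w s" by (intro mult_left_mono) auto
    then have "1 \<le> (8/9) ^ p * ?w s" by (simp flip: power_mult_distrib)
    then have "ennreal 1 \<le> ennreal ((8/9) ^ p * ?w s)" by (rule ennreal_leI)
    then show ?thesis using True by (simp add: ennreal_mult)
  qed simp
  then have "(\<integral>\<^sup>+ s. indicator ?B s \<partial>run A xs adv t)
      \<le> (\<integral>\<^sup>+ s. ennreal ((8/9) ^ p) * ennreal (?w s) \<partial>run A xs adv t)"
    by (intro nn_integral_mono) blast
  also have "\<dots> = ennreal ((8/9) ^ p) * (\<integral>\<^sup>+ s. ennreal (?w s) \<partial>run A xs adv t)"
    by (simp add: nn_integral_cmult)
  also have "\<dots> \<le> ennreal ((8/9) ^ p) * 1"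
    by (intro mult_left_mono nn_integral_weight_run_le) simp
  finally show ?thesis by (simp add: measure_pmf.emeasure_eq_measure)
qed

lemma nn_integral_card_wrong_le:
  "(\<integral>\<^sup>+ s. of_nat (card (wrong d xs (2 * p) (fst s))) \<partial>run A xs adv t)
     \<le> ennreal (real (length xs) * (8/9) ^ p)"
proof -
  let ?B = "\<lambda>i. {s :: config. i \<in> wrong d xs (2 * p) (fst s)}"
  have "of_nat (card (wrong d xs (2 * p) (fst s))) = (\<Sum>i<length xs. indicator (?B i) s :: ennreal)"
    for s :: config
  proof -
    have "wrong d xs (2 * p) (fst s) = {i \<in> {..<length xs}. s \<in> ?B i}" by (auto simp: wrong_def)
    then show ?thesis by (simp add: indicator_def sum.If_cases Int_def)
  qed
  then have "(\<integral>\<^sup>+ s. of_nat (card (wrong d xs (2 * p) (fst s))) \<partial>run A xs adv t)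
      = (\<Sum>i<length xs. emeasure (run A xs adv t) (?B i))"
    by (simp add: nn_integral_sum)
  also have "\<dots> \<le> (\<Sum>i<length xs. ennreal ((8/9) ^ p))"
    by (intro sum_mono) (simp add: measure_pmf.emeasure_eq_measure prob_wrong_le ennreal_leI)
  also have "\<dots> = ennreal (real (length xs) * (8/9) ^ p)"
    by (simp add: ennreal_mult ennreal_of_nat_eq_real_of_nat)
  finally show ?thesis .
qed

section \<open>An algorithm that knows the input values\<close>

text \<open>Here \<open>2 * p\<close> and \<open>2 * P n\<close> are the numbers of queries for the first claim and for the
  examination of an element. The default \<open>v\<close> of the majority makes an element without a majority
  suspicious.\<close>

locale screening =
  fixes v :: real and J :: "real list" and p :: nat and P :: "nat \<Rightarrow> nat"
  assumes distinct_J: "distinct J"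
    and p_less: "\<And>n. p < P n"
    and error_le: "\<And>n. 2 * (8/9) ^ p + real n * (8/9) ^ P n \<le> 1/3"
begin

definition settled :: "nat \<Rightarrow> transcript \<Rightarrow> nat \<Rightarrow> bool" where
  "settled n h i \<longleftrightarrow> 2 * P n \<le> length (answers i h)"

text \<open>The first claim stays in force during an examination, until all \<open>2 * P n\<close>
  answers have arrived.\<close>

definition claim :: "nat \<Rightarrow> transcript \<Rightarrow> nat \<Rightarrow> real" where
  "claim n h i = majority v (take (2 * (if settled n h i then P n else p)) (answers i h))"

text \<open>Once the length or the settled claims refute that the input is a permutation of
  \<open>J\<close>, every element becomes suspicious, and knowledge of \<open>J\<close> is no longer
  relied on.\<close>

definition consistent :: "nat \<Rightarrow> transcript \<Rightarrow> bool" where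
  "consistent n h \<longleftrightarrow> n = length J \<and> inj_on (claim n h) {i. i < n \<and> settled n h i} \<and>
     claim n h ` {i. i < n \<and> settled n h i} \<subseteq> set J"

definition suspicious :: "nat \<Rightarrow> transcript \<Rightarrow> nat \<Rightarrow> bool" where
  "suspicious n h i \<longleftrightarrow> v \<le> claim n h i \<or> claim n h i \<notin> set J \<or> \<not> consistent n h \<or>
     (\<exists>j<n. j \<noteq> i \<and> 2 * p \<le> length (answers j h) \<and> claim n h j = claim n h i)"

text \<open>Suspicion matters only at exactly \<open>2 * p\<close> answers, so an examination once
  begun is completed.\<close>

definition pending :: "nat \<Rightarrow> transcript \<Rightarrow> nat \<Rightarrow> bool" where
  "pending n h i \<longleftrightarrow> i < n \<and> \<not> settled n h i \<and>
     (length (answers i h) = 2 * p \<longrightarrow> suspicious n h i)"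

definition screen :: algorithm where
  "screen n h = return_pmf (if \<exists>i. pending n h i then Query (SOME i. pending n h i)
     else Output {i. i < n \<and> v \<le> claim n h i})"

lemma Query_screenD: "Query i \<in> set_pmf (screen n h) \<Longrightarrow> pending n h i"
  by (auto simp: screen_def intro: someI split: if_splits)

lemma Output_screenD:
  "Output S \<in> set_pmf (screen n h) \<Longrightarrow> (\<forall>i. \<not> pending n h i) \<and> S = {i. i < n \<and> v \<le> claim n h i}"
  by (auto simp: screen_def split: if_splits)

lemma valid_screen: "valid_algorithm screen"
  unfolding valid_algorithm_def using Query_screenD by (auto simp: pending_def)

section \<open>Length and termination of screening runs\<close>

lemma run_screen_invariant:
  assumes "s \<in> set_pmf (run screen xs adv t)"
  shows "fst ` set (fst s) \<subseteq> {..<length xs} \<and>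
    (\<forall>i. length (answers i (fst s)) \<le> 2 * P (length xs)) \<and>
    (\<forall>S. snd s = Some S \<longrightarrow> (\<forall>i. \<not> pending (length xs) (fst s) i) \<and>
       S = {i. i < length xs \<and> v \<le> claim (length xs) (fst s) i})"
proof (rule run_invariant[OF _ _ _ assms, where P = "\<lambda>h out. fst ` set h \<subseteq> {..<length xs} \<and>
    (\<forall>i. length (answers i h) \<le> 2 * P (length xs)) \<and>
    (\<forall>S. out = Some S \<longrightarrow> (\<forall>i. \<not> pending (length xs) h i) \<and>
       S = {i. i < length xs \<and> v \<le> claim (length xs) h i})"], goal_cases)
  case (2 h S)
  then show ?case using Output_screenD[OF 2(2)] by simp
next
  case (3 h i y)
  then show ?case using Query_screenD[OF 3(2)] by (auto simp: pending_def settled_def)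
qed simp

lemma length_run_screen:
  assumes "s \<in> set_pmf (run screen xs adv t)"
  shows "length (fst s) \<le> 2 * p * length xs
    + 2 * P (length xs) * card {i. i < length xs \<and> 2 * p < length (answers i (fst s))}"
proof -
  let ?n = "length xs" and ?h = "fst s"
  note inv = run_screen_invariant[OF assms]
  have "length ?h = (\<Sum>i<?n. length (answers i ?h))"
    using inv by (intro length_eq_sum_answers) auto
  also have "\<dots> \<le> (\<Sum>i<?n. 2 * p + (if 2 * p < length (answers i ?h) then 2 * P ?n else 0))"
    using inv by (intro sum_mono) (auto simp: trans_le_add2)
  also have "\<dots> = 2 * p * ?n + 2 * P ?n * card {i. i < ?n \<and> 2 * p < length (answers i ?h)}"
    by (simp add: sum.distrib sum.If_cases Int_def)
  finally show ?thesis .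
qed

text \<open>Every step before the output is a query, and settled elements are not queried; the
  additional step exceeds the largest possible number of queries.\<close>

lemma run_screen_halts:
  assumes "s \<in> set_pmf (run screen xs adv (2 * P (length xs) * length xs + 1))"
  shows "snd s \<noteq> None"
proof
  assume None: "snd s = None"
  let ?n = "length xs" and ?h = "fst s"
  note inv = run_screen_invariant[OF assms]
  have "length ?h = (\<Sum>i<?n. length (answers i ?h))"
    using inv by (intro length_eq_sum_answers) auto
  also have "\<dots> \<le> (\<Sum>i<?n. 2 * P ?n)" using inv by (intro sum_mono) auto
  finally show False using run_None_length[OF assms None] by simp
qed

section \<open>Correctness of screening on every input\<close>

lemma claim_settled:
  assumes "wrong v xs (2 * P (length xs)) h = {}" "i < length xs" "settled (length xs) h i"
  shows "claim (length xs) h i = xs ! i"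
  using assms by (auto simp: claim_def settled_def wrong_def)

lemma claim_unsettled:
  assumes "i < length xs" "\<not> settled (length xs) h i" "2 * p \<le> length (answers i h)"
    "i \<notin> wrong v xs (2 * p) h"
  shows "claim (length xs) h i = xs ! i"
  using assms by (auto simp: claim_def wrong_def)

text \<open>A wrong output needs an unsettled element, as settled claims are true under
  \<open>ok\<close>. This element is not suspicious, so the settled claims are consistent; every
  unsettled claim is in \<open>J\<close>, below \<open>v\<close> and not shared. Hence the claims
  enumerate \<open>J\<close>, and as claims of at least \<open>v\<close> are settled, the output can
  only miss elements.\<close>

lemma final_claims:
  assumes fin: "\<forall>i. \<not> pending n h i" and n: "n = length xs"
    and ok: "wrong v xs (2 * P n) h = {}"
    and ne: "{i. i < n \<and> v \<le> claim n h i} \<noteq> threshold_set v xs"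
  shows "inj_on (claim n h) {..<n}" and "claim n h ` {..<n} = set J"
    and "\<And>i. i < n \<Longrightarrow> v \<le> claim n h i \<Longrightarrow> settled n h i"
    and "\<And>i. i < n \<Longrightarrow> claim n h i \<noteq> xs ! i \<Longrightarrow> i \<in> wrong v xs (2 * p) h"
    and "\<exists>i<n. claim n h i < v \<and> v \<le> xs ! i"
proof -
  have true: "claim n h i = xs ! i" if "i < n" "settled n h i" for i
    using claim_settled ok that n by simp
  have uns: "length (answers i h) = 2 * p" "\<not> suspicious n h i" if "i < n" "\<not> settled n h i" for i
    using fin that by (auto simp: pending_def)
  have "{i. i < n \<and> v \<le> claim n h i} = threshold_set v xs" if "\<forall>i<n. settled n h i"
    using that true n by (auto simp: threshold_set_def)
  then obtain i0 where i0: "i0 < n" "\<not> settled n h i0" using ne by blast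
  have con: "consistent n h" using uns(2)[OF i0] by (auto simp: suspicious_def)
  have len: "2 * p \<le> length (answers i h)" if "i < n" for i
    using uns(1)[of i] that p_less[of n] by (cases "settled n h i") (auto simp: settled_def)
  show inj: "inj_on (claim n h) {..<n}"
  proof (rule inj_onI, rule ccontr)
    fix i j assume ij: "i \<in> {..<n}" "j \<in> {..<n}" "claim n h i = claim n h j" "i \<noteq> j"
    have "settled n h i" "settled n h j"
      using uns(2)[of i] uns(2)[of j] ij len by (auto simp: suspicious_def)
    then show False using con ij by (auto simp: consistent_def inj_on_def)
  qed
  have sub: "claim n h ` {..<n} \<subseteq> set J"
  proof
    fix y assume "y \<in> claim n h ` {..<n}"
    then obtain i where i: "i < n" "y = claim n h i" by auto
    show "y \<in> set J"
      using uns(2)[of i] con i by (cases "settled n h i") (auto simp: suspicious_def consistent_def)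
  qed
  have "card (claim n h ` {..<n}) = card (set J)"
    using inj con distinct_J by (simp add: card_image consistent_def distinct_card)
  then show "claim n h ` {..<n} = set J" using sub by (intro card_subset_eq) auto
  show big: "settled n h i" if "i < n" "v \<le> claim n h i" for i
    using uns(2)[of i] that by (auto simp: suspicious_def)
  show "i \<in> wrong v xs (2 * p) h" if "i < n" "claim n h i \<noteq> xs ! i" for i
    using true[of i] claim_unsettled[of i xs h] that len[of i] n by auto
  show "\<exists>i<n. claim n h i < v \<and> v \<le> xs ! i"
  proof (rule ccontr)
    assume "\<not> ?thesis"
    then have "{i. i < n \<and> v \<le> claim n h i} = threshold_set v xs"
      using true big n by (force simp: threshold_set_def)
    then show False using ne by simp
  qed
qed

text \<open>A wrong output misses an element of value at least \<open>v\<close>, although each such value of \<open>J\<close> is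
  rightly claimed by exactly one element. So the input has such a value outside \<open>J\<close>, or has one
  twice, and one of at most two elements that depend only on the input has been misjudged.\<close>

lemma final_output_correct:
  "\<exists>i1 i2. \<forall>h. (\<forall>i. \<not> pending (length xs) h i) \<longrightarrow> wrong v xs (2 * P (length xs)) h = {} \<longrightarrow>
     {i. i < length xs \<and> v \<le> claim (length xs) h i} = threshold_set v xs \<or>
     i1 \<in> wrong v xs (2 * p) h \<or> i2 \<in> wrong v xs (2 * p) h"
proof -
  let ?n = "length xs"
  consider (new) i where "i < ?n" "xs ! i \<notin> set J"
    | (twice) i j where "i < ?n" "j < ?n" "i \<noteq> j" "xs ! i = xs ! j"
    | (sub) "\<And>i. i < ?n \<Longrightarrow> xs ! i \<in> set J"
        "\<And>i j. i < ?n \<Longrightarrow> j < ?n \<Longrightarrow> xs ! i = xs ! j \<Longrightarrow> i = j"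
    by metis
  then show ?thesis
  proof cases
    case new
    then have "i \<in> wrong v xs (2 * p) h" if "\<forall>i. \<not> pending ?n h i"
      "wrong v xs (2 * P ?n) h = {}" "{i. i < ?n \<and> v \<le> claim ?n h i} \<noteq> threshold_set v xs" for h
      using final_claims(2,4)[OF that(1) refl that(2,3)] by (metis imageI lessThan_iff)
    then show ?thesis by blast
  next
    case twice
    then have "i \<in> wrong v xs (2 * p) h \<or> j \<in> wrong v xs (2 * p) h" if "\<forall>i. \<not> pending ?n h i"
      "wrong v xs (2 * P ?n) h = {}" "{i. i < ?n \<and> v \<le> claim ?n h i} \<noteq> threshold_set v xs" for h
      using final_claims(1,4)[OF that(1) refl that(2,3)] by (metis inj_onD lessThan_iff)
    then show ?thesis by blast
  next
    case sub
    have "{i. i < ?n \<and> v \<le> claim ?n h i} = threshold_set v xs" if that: "\<forall>i. \<not> pending ?n h i"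
      "wrong v xs (2 * P ?n) h = {}" for h
    proof (rule ccontr)
      assume ne: "\<not> ?thesis"
      note fc = final_claims[OF that(1) refl that(2) ne]
      obtain i where i: "i < ?n" "claim ?n h i < v" "v \<le> xs ! i" using fc(5) by blast
      \<comment> \<open>The missed value has a claimant \<open>j\<close>. Its claim is at least
        \<open>v\<close>, hence settled and true, so \<open>j\<close> is \<open>i\<close> itself,
        whose claim is below \<open>v\<close>.\<close>
      obtain j where j: "j < ?n" "claim ?n h j = xs ! i" using fc(2) sub(1)[OF i(1)] by force
      then have "xs ! j = xs ! i" using fc(3)[of j] i claim_settled[OF that(2), of j] by simp
      then show False using sub(2)[of j i] i j by auto
    qed
    then show ?thesis by blast
  qed
qed

text \<open>The error bound \<open>(8/9) ^ p\<close> of a first claim does not shrink with the input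
  length, so a union bound over all first claims is too weak. By
  \<open>final_output_correct\<close>, only those of \<open>i1\<close> and \<open>i2\<close> and the
  examinations are charged, as in \<open>error_le\<close>.\<close>

lemma correct_screen: "correct_on v screen xs"
  unfolding correct_on_def
proof
  fix adv
  let ?n = "length xs"
  define t where "t = 2 * P ?n * ?n + 1"
  define M where "M = run screen xs adv t"
  obtain i1 i2 where i12: "\<forall>h. (\<forall>i. \<not> pending ?n h i) \<longrightarrow> wrong v xs (2 * P ?n) h = {} \<longrightarrow>
     {i. i < ?n \<and> v \<le> claim ?n h i} = threshold_set v xs \<or>
     i1 \<in> wrong v xs (2 * p) h \<or> i2 \<in> wrong v xs (2 * p) h"
    using final_output_correct[of xs] by (elim exE)
  define G where "G = {s :: config. snd s = Some (threshold_set v xs)}"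
  define W where "W i q = {s :: config. i \<in> wrong v xs (2 * q) (fst s)}" for i q
  have "s \<in> W i1 p \<union> W i2 p \<union> (\<Union>i<?n. W i (P ?n))" if s: "s \<in> set_pmf M" "s \<notin> G" for s
  proof -
    have "snd s \<noteq> None"
      by (rule run_screen_halts) (use s(1) in \<open>simp only: M_def t_def\<close>)
    then obtain S where S: "snd s = Some S" by blast
    have "(\<forall>i. \<not> pending ?n (fst s) i)" "S = {i. i < ?n \<and> v \<le> claim ?n (fst s) i}"
      using run_screen_invariant[OF s(1)[unfolded M_def]] S by blast+
    then have "wrong v xs (2 * P ?n) (fst s) \<noteq> {} \<or> i1 \<in> wrong v xs (2 * p) (fst s)
        \<or> i2 \<in> wrong v xs (2 * p) (fst s)"
      using i12[THEN spec, of "fst s"] s(2) S by (simp add: G_def)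
    moreover have "wrong v xs (2 * P ?n) (fst s) \<subseteq> {..<?n}" by (auto simp: wrong_def)
    ultimately show ?thesis unfolding W_def by blast
  qed
  then have "measure_pmf.prob M (- G)
      \<le> measure_pmf.prob M (W i1 p \<union> W i2 p \<union> (\<Union>i<?n. W i (P ?n)))"
    by (intro measure_pmf.finite_measure_mono_AE) (auto simp: AE_measure_pmf_iff)
  also have "\<dots> \<le> measure_pmf.prob M (W i1 p) + measure_pmf.prob M (W i2 p)
      + measure_pmf.prob M (\<Union>i<?n. W i (P ?n))"
    by (intro order_trans[OF measure_Un_le] add_mono) (auto intro: measure_Un_le)
  also have "measure_pmf.prob M (\<Union>i<?n. W i (P ?n)) \<le> (\<Sum>i<?n. measure_pmf.prob M (W i (P ?n)))"
    by (intro measure_UNION_le) auto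
  also have "\<dots> \<le> (\<Sum>i<?n. (8/9) ^ P ?n)"
    unfolding M_def W_def by (intro sum_mono prob_wrong_le)
  also have "measure_pmf.prob M (W i1 p) \<le> (8/9) ^ p"
    unfolding M_def W_def by (rule prob_wrong_le)
  also have "measure_pmf.prob M (W i2 p) \<le> (8/9) ^ p"
    unfolding M_def W_def by (rule prob_wrong_le)
  finally have "measure_pmf.prob M (- G) \<le> 1/3" using error_le[of ?n] by simp
  then have "2/3 \<le> measure_pmf.prob M G"
    using measure_pmf.prob_compl[of G M] by (simp add: Compl_eq_Diff_UNIV)
  also have "\<dots> \<le> success_prob v screen xs adv"
    unfolding success_prob_def M_def G_def
    by (intro cSUP_upper bdd_aboveI[of _ 1]) auto
  finally show "2/3 \<le> success_prob v screen xs adv" .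
qed

lemma screen_in_correct_algorithms: "screen \<in> correct_algorithms v"
  using valid_screen correct_screen by (auto simp: correct_algorithms_def)

section \<open>Query complexity of screening on permutations of \<open>J\<close>\<close>

text \<open>On a permutation of \<open>J\<close>, an element that is judged rightly and has a value below \<open>v\<close> becomes
  suspicious only if some misjudged element claims its value.\<close>

definition exposed :: "real list \<Rightarrow> transcript \<Rightarrow> nat set" where
  "exposed xs h = wrong v xs (2 * p) h \<union> threshold_set v xs \<union>
     {i. i < length xs \<and>
       (\<exists>j \<in> wrong v xs (2 * p) h. majority v (take (2 * p) (answers j h)) = xs ! i)}"

lemma exposed_snoc_mono: "exposed xs h \<subseteq> exposed xs (h @ [(i, y)])"
proof -
  have "majority v (take (2 * p) (answers j (h @ [(i, y)]))) = majority v (take (2 * p) (answers j h))"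
    if "j \<in> wrong v xs (2 * p) h" for j
    using that by (subst take_answers_snoc) (auto simp: wrong_def)
  then show ?thesis
    using wrong_snoc_mono[of v xs "2 * p" h i y] unfolding exposed_def by fastforce
qed

text \<open>Each misjudged element claims one value, which has at most one owner in a distinct
  list.\<close>

lemma card_exposed_le:
  assumes "distinct xs"
  shows "card (exposed xs h) \<le> 2 * card (wrong v xs (2 * p) h) + card (threshold_set v xs)"
proof -
  let ?W = "wrong v xs (2 * p) h" and ?m = "\<lambda>j. majority v (take (2 * p) (answers j h))"
  let ?E = "{i. i < length xs \<and> (\<exists>j \<in> ?W. ?m j = xs ! i)}"
  have "inj_on ((!) xs) ?E" using assms by (auto simp: inj_on_def nth_eq_iff_index_eq)
  then have "card ?E = card ((!) xs ` ?E)" by (simp add: card_image)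
  also have "\<dots> \<le> card (?m ` ?W)"
    by (intro card_mono subsetI) (auto, metis imageI)
  also have "\<dots> \<le> card ?W" by (rule card_image_le) simp
  finally have "card ?E \<le> card ?W" .
  moreover have "card (exposed xs h) \<le> card ?W + card (threshold_set v xs) + card ?E"
    unfolding exposed_def by (intro order_trans[OF card_Un_le] add_mono) (auto intro: card_Un_le)
  ultimately show ?thesis by linarith
qed

lemma pending_exposed:
  assumes perm: "mset xs = mset J" and pend: "pending (length xs) h i"
    and len: "length (answers i h) = 2 * p" and ok: "wrong v xs (2 * P (length xs)) h = {}"
  shows "i \<in> exposed xs h"
proof (rule ccontr)
  assume not_exposed: "i \<notin> exposed xs h"
  let ?n = "length xs"
  have xs: "set xs = set J" "length xs = length J" "distinct xs"
    using perm distinct_J mset_eq_setD mset_eq_length mset_eq_imp_distinct_iff by blast+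
  have i: "i < ?n" "\<not> settled ?n h i" using pend by (auto simp: pending_def)
  have ci: "claim ?n h i = xs ! i"
    using claim_unsettled[of i xs h] i len not_exposed by (auto simp: exposed_def)
  have cs: "claim ?n h j = xs ! j" if "j < ?n" "settled ?n h j" for j
    using claim_settled[OF ok] that by simp
  have "consistent ?n h"
    unfolding consistent_def using xs cs by (auto simp: inj_on_def nth_eq_iff_index_eq)
  moreover have "suspicious ?n h i" using pend len by (auto simp: pending_def)
  \<comment> \<open>With a consistent transcript and a claim in \<open>J\<close> below
    \<open>v\<close>, only a rival \<open>j\<close> can cause suspicion. As values are distinct, its
    claim is false, hence an unsettled first claim.\<close>
  ultimately obtain j where j: "j < ?n" "j \<noteq> i" "2 * p \<le> length (answers j h)"
      "claim ?n h j = claim ?n h i"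
    using ci i xs not_exposed by (force simp: suspicious_def exposed_def threshold_set_def)
  then have neq: "claim ?n h j \<noteq> xs ! j" using ci i xs by (auto simp: nth_eq_iff_index_eq)
  then have "\<not> settled ?n h j" "j \<in> wrong v xs (2 * p) h"
    using cs[of j] claim_unsettled[of j xs h] j by auto
  moreover from this have "majority v (take (2 * p) (answers j h)) = xs ! i"
    using j ci by (simp add: claim_def)
  ultimately show False using not_exposed i by (auto simp: exposed_def)
qed

text \<open>An examination begins at a pending element with exactly \<open>2 * p\<close> answers,
  which is exposed by \<open>pending_exposed\<close> and remains so. If some examination has failed,
  the term with the factor \<open>length xs\<close> covers all elements.\<close>

lemma card_opened_le:
  assumes perm: "mset xs = mset J" and s: "s \<in> set_pmf (run screen xs adv t)"
  shows "card {i. i < length xs \<and> 2 * p < length (answers i (fst s))}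
    \<le> 2 * card (wrong v xs (2 * p) (fst s)) + card (threshold_set v xs)
      + length xs * card (wrong v xs (2 * P (length xs)) (fst s))"
proof -
  let ?W = "\<lambda>h. wrong v xs (2 * P (length xs)) h"
  have inv: "?W (fst s) \<noteq> {} \<or> (\<forall>i. 2 * p < length (answers i (fst s)) \<longrightarrow> i \<in> exposed xs (fst s))"
  proof (rule run_invariant[OF _ _ _ s, where P = "\<lambda>h out. ?W h \<noteq> {} \<or>
      (\<forall>i. 2 * p < length (answers i h) \<longrightarrow> i \<in> exposed xs h)"], goal_cases)
    case (3 h i y)
    note pend = Query_screenD[OF 3(2)]
    show ?case
    proof (cases "?W h = {}")
      case True
      have "j \<in> exposed xs (h @ [(i, y)])" if "2 * p < length (answers j (h @ [(i, y)]))" for j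
      proof (cases "2 * p < length (answers j h)")
        case False
        then have "j = i" "length (answers i h) = 2 * p" using that by (auto split: if_splits)
        then show ?thesis using pending_exposed[OF perm pend _ True] exposed_snoc_mono by blast
      qed (use True 3(1) exposed_snoc_mono in blast)
      then show ?thesis by blast
    qed (use wrong_snoc_mono in blast)
  qed auto
  show ?thesis
  proof (cases "?W (fst s) = {}")
    case True
    have "distinct xs" using perm distinct_J mset_eq_imp_distinct_iff by blast
    moreover have "card {i. i < length xs \<and> 2 * p < length (answers i (fst s))}
        \<le> card (exposed xs (fst s))"
      using inv True by (intro card_mono) (auto simp: exposed_def threshold_set_def)
    ultimately show ?thesis using card_exposed_le[of xs "fst s"] by linarith
  next
    case False
    then have "card (?W (fst s)) \<ge> 1" by (simp add: Suc_le_eq card_gt_0_iff)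
    then have "length xs * 1 \<le> length xs * card (?W (fst s))" by (rule mult_le_mono2)
    moreover have "card {i. i < length xs \<and> 2 * p < length (answers i (fst s))} \<le> card {..<length xs}"
      by (intro card_mono) auto
    ultimately show ?thesis by (simp only: card_lessThan mult_1_right)
  qed
qed

text \<open>The term quadratic in \<open>n\<close> pays for failed examinations, after which every
  element may be examined.\<close>

lemma query_complexity_screen_le:
  assumes perm: "mset xs = mset J" and n: "n = length J" and k: "k = card (threshold_set v xs)"
  shows "query_complexity screen xs \<le> ennreal (2 * real p * real n
    + 2 * real (P n) * (2 * (real n * (8/9) ^ p) + real k + real n * (real n * (8/9) ^ P n)))"
proof -
  have len: "length xs = n" using perm n mset_eq_length by blast
  let ?w = "\<lambda>q s. of_nat (card (wrong v xs (2 * q) (fst s))) :: ennreal"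
  have "(\<integral>\<^sup>+ s. of_nat (length (fst s)) \<partial>run screen xs adv t) \<le> ennreal (2 * real p * real n
    + 2 * real (P n) * (2 * (real n * (8/9) ^ p) + real k + real n * (real n * (8/9) ^ P n)))" for adv t
  proof -
    let ?M = "measure_pmf (run screen xs adv t)"
    have "(\<integral>\<^sup>+ s. of_nat (length (fst s)) \<partial>?M)
        \<le> (\<integral>\<^sup>+ s. of_nat (2 * p * n + 2 * P n * k)
            + (of_nat (4 * P n) * ?w p s + of_nat (2 * P n * n) * ?w (P n) s) \<partial>?M)"
    proof (intro nn_integral_mono_AE AE_pmfI)
      fix s assume s: "s \<in> set_pmf (run screen xs adv t)"
      have "length (fst s) \<le> 2 * p * n + 2 * P n *
          card {i. i < length xs \<and> 2 * p < length (answers i (fst s))}"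
        using length_run_screen[OF s] len by simp
      also have "\<dots> \<le> 2 * p * n + 2 * P n * (2 * card (wrong v xs (2 * p) (fst s)) + k
          + n * card (wrong v xs (2 * P n) (fst s)))"
        using card_opened_le[OF perm s] len k by (intro add_left_mono mult_le_mono2) simp
      finally have "of_nat (length (fst s)) \<le> (of_nat (2 * p * n + 2 * P n *
          (2 * card (wrong v xs (2 * p) (fst s)) + k
          + n * card (wrong v xs (2 * P n) (fst s)))) :: ennreal)"
        by (simp only: of_nat_le_iff)
      also have "\<dots> = of_nat (2 * p * n + 2 * P n * k)
            + (of_nat (4 * P n) * ?w p s + of_nat (2 * P n * n) * ?w (P n) s)"
        by (simp add: algebra_simps)
      finally show "of_nat (length (fst s)) \<le> of_nat (2 * p * n + 2 * P n * k)
            + (of_nat (4 * P n) * ?w p s + of_nat (2 * P n * n) * ?w (P n) s)" .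
    qed
    also have "\<dots> = of_nat (2 * p * n + 2 * P n * k) + (of_nat (4 * P n) * (\<integral>\<^sup>+ s. ?w p s \<partial>?M)
        + of_nat (2 * P n * n) * (\<integral>\<^sup>+ s. ?w (P n) s \<partial>?M))"
      by (simp add: nn_integral_add nn_integral_cmult)
    also have "\<dots> \<le> of_nat (2 * p * n + 2 * P n * k) + (of_nat (4 * P n) * ennreal (real n * (8/9) ^ p)
        + of_nat (2 * P n * n) * ennreal (real n * (8/9) ^ P n))"
      using nn_integral_card_wrong_le[where d = v and xs = xs and A = screen and adv = adv and t = t] len
      by (intro add_mono mult_left_mono) auto
    also have "\<dots> = ennreal (real (2 * p * n + 2 * P n * k) + (real (4 * P n) * (real n * (8/9) ^ p)
        + real (2 * P n * n) * (real n * (8/9) ^ P n)))"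
      by (simp only: ennreal_of_nat_eq_real_of_nat ennreal_plus ennreal_mult of_nat_0_le_iff
        mult_nonneg_nonneg add_nonneg_nonneg zero_le_power zero_le_divide_iff zero_le_numeral simp_thms)
    also have "real (2 * p * n + 2 * P n * k) + (real (4 * P n) * (real n * (8/9) ^ p)
        + real (2 * P n * n) * (real n * (8/9) ^ P n)) = 2 * real p * real n
        + 2 * real (P n) * (2 * (real n * (8/9) ^ p) + real k + real n * (real n * (8/9) ^ P n))"
      by (simp add: algebra_simps)
    finally show ?thesis .
  qed
  then show ?thesis unfolding query_complexity_def expected_queries_def by (intro SUP_least)
qed

end

section \<open>Lower bound for algorithms that do not know the input values\<close>

text \<open>The index in the value keeps all pairs disjoint. With \<open>liar\<close>, both possible
  answers of an element are the same for every \<open>S\<close>; only their probabilities depend on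
  \<open>S\<close>.\<close>

definition hidden :: "real \<Rightarrow> nat \<Rightarrow> nat set \<Rightarrow> real list" where
  "hidden v n S = map (\<lambda>i. if i \<in> S then v + real i else v - 1 - real i) [0..<n]"

definition liar :: "real \<Rightarrow> nat set \<Rightarrow> adversary" where
  "liar v S h i = (if i \<in> S then v - 1 - real i else v + real i)"

lemma length_hidden [simp]: "length (hidden v n S) = n"
  by (simp add: hidden_def)

lemma nth_hidden: "i < n \<Longrightarrow> hidden v n S ! i = (if i \<in> S then v + real i else v - 1 - real i)"
  by (simp add: hidden_def)

lemma threshold_set_hidden: "S \<subseteq> {..<n} \<Longrightarrow> threshold_set v (hidden v n S) = S"
  by (auto simp: threshold_set_def nth_hidden split: if_splits)

lemma distinct_hidden: "distinct (hidden v n S)"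
  unfolding hidden_def distinct_map by (auto simp: inj_on_def split: if_splits)

lemma hidden_in_many_distinct_values: "c \<le> 1 \<Longrightarrow> hidden v n S \<in> many_distinct_values c"
  using mult_right_mono[of c 1 "real n"]
  by (simp add: many_distinct_values_def distinct_card[OF distinct_hidden])

text \<open>An answer of element \<open>i\<close> that has probability \<open>q\<close> if \<open>i\<close> is small has probability at least
  \<open>q / 2\<close> if \<open>i\<close> is large, and no other answer is affected.\<close>

lemma change_of_measure:
  assumes B: "valid_algorithm B" and i: "i < n" "i \<notin> S"
  shows "(\<integral>\<^sup>+ s. f s * ennreal ((1/2) ^ length (answers i (fst s)))
        \<partial>run B (hidden v n S) (liar v S) t)
    \<le> (\<integral>\<^sup>+ s. f s \<partial>run B (hidden v n (insert i S)) (liar v (insert i S)) t)"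
proof (induction t arbitrary: f)
  case (Suc t)
  define w :: "config \<Rightarrow> ennreal" where "w s = ennreal ((1/2) ^ length (answers i (fst s)))" for s
  let ?S = "step B (hidden v n S) (liar v S)"
  let ?T = "step B (hidden v n (insert i S)) (liar v (insert i S))"
  have step: "(\<integral>\<^sup>+ s. f s * w s \<partial>?S c) \<le> (\<integral>\<^sup>+ s. f s \<partial>?T c) * w c" for c
  proof (cases c)
    case (Pair h out)
    show ?thesis
    proof (cases out)
      case None
      let ?g = "\<lambda>S a. case a of Output S' \<Rightarrow> f (h, Some S')
         | Query j \<Rightarrow> ennreal (2/3) * f (h @ [(j, hidden v n S ! j)], None)
                 + ennreal (1/3) * f (h @ [(j, liar v S h j)], None)"
      let ?gw = "\<lambda>a. case a of Output S' \<Rightarrow> f (h, Some S') * w (h, Some S')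
         | Query j \<Rightarrow> ennreal (2/3) * (f (h @ [(j, hidden v n S ! j)], None)
                    * w (h @ [(j, hidden v n S ! j)], None))
                 + ennreal (1/3) * (f (h @ [(j, liar v S h j)], None)
                    * w (h @ [(j, liar v S h j)], None))"
      have "?gw a \<le> ?g (insert i S) a * w (h, None)" if a: "a \<in> set_pmf (B n h)" for a
      proof (cases a)
        case (Query j)
        then have j: "j < n" using B a by (auto simp: valid_algorithm_def)
        show ?thesis
        proof (cases "j = i")
          case True
          have wi: "w (h @ [(i, y)], None) = ennreal (1/2) * w (h, None)" for y
            unfolding w_def by (subst ennreal_mult[symmetric]) simp_all
          let ?x = "f (h @ [(i, v - 1 - real i)], None)" and ?y = "f (h @ [(i, v + real i)], None)"
          have "ennreal (2/3) * (?x * (ennreal (1/2) * w (h, None)))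
              + ennreal (1/3) * (?y * (ennreal (1/2) * w (h, None)))
            = ((ennreal (2/3) * ennreal (1/2)) * ?x + (ennreal (1/3) * ennreal (1/2)) * ?y) * w (h, None)"
            by (simp only: algebra_simps)
          \<comment> \<open>The probabilities of the two answers of \<open>i\<close> change from
            \<open>2/3\<close> to \<open>1/3\<close> and from \<open>1/3\<close> to
            \<open>2/3\<close>; the factor \<open>1/2\<close> covers the worse case.\<close>
          also have "\<dots> \<le> (ennreal (1/3) * ?x + ennreal (2/3) * ?y) * w (h, None)"
          proof -
            have "ennreal (2/3) * ennreal (1/2) \<le> ennreal (1/3)"
              "ennreal (1/3) * ennreal (1/2) \<le> ennreal (2/3)"
              by (subst ennreal_mult[symmetric]; auto intro!: ennreal_leI)+
            then show ?thesis by (intro mult_right_mono add_mono) auto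
          qed
          also have "\<dots> = (ennreal (2/3) * ?y + ennreal (1/3) * ?x) * w (h, None)"
            by (simp only: add.commute)
          finally show ?thesis
            unfolding Query True using i by (simp only: action.case wi) (simp add: nth_hidden liar_def)
        next
          case False
          then have "w (h @ [(j, y)], None) = w (h, None)" for y by (simp add: w_def)
          moreover have "hidden v n (insert i S) ! j = hidden v n S ! j"
            "liar v (insert i S) h j = liar v S h j"
            using False j by (auto simp: nth_hidden liar_def)
          ultimately show ?thesis unfolding Query by (simp add: algebra_simps)
        qed
      qed (simp add: w_def)
      then have "(\<integral>\<^sup>+ a. ?gw a \<partial>B n h) \<le> (\<integral>\<^sup>+ a. ?g (insert i S) a * w (h, None) \<partial>B n h)"
        by (intro nn_integral_mono_AE AE_pmfI) blast
      also have "\<dots> = (\<integral>\<^sup>+ a. ?g (insert i S) a \<partial>B n h) * w (h, None)"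
        by (rule nn_integral_multc) simp
      finally show ?thesis
        unfolding Pair None nn_integral_step_None length_hidden .
    qed (simp add: Pair nn_integral_step_Some w_def)
  qed
  have "(\<integral>\<^sup>+ s. f s * w s \<partial>run B (hidden v n S) (liar v S) (Suc t))
      = (\<integral>\<^sup>+ c. (\<integral>\<^sup>+ s. f s * w s \<partial>?S c) \<partial>run B (hidden v n S) (liar v S) t)"
    by simp
  also have "\<dots> \<le> (\<integral>\<^sup>+ c. (\<integral>\<^sup>+ s. f s \<partial>?T c) * w c \<partial>run B (hidden v n S) (liar v S) t)"
    by (intro nn_integral_mono step)
  \<comment> \<open>The induction hypothesis is applied to the expectation of \<open>f\<close> after
    one further step.\<close>
  also have "\<dots> \<le> (\<integral>\<^sup>+ c. (\<integral>\<^sup>+ s. f s \<partial>?T c)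
      \<partial>run B (hidden v n (insert i S)) (liar v (insert i S)) t)"
    unfolding w_def by (rule Suc.IH)
  also have "\<dots> = (\<integral>\<^sup>+ s. f s \<partial>run B (hidden v n (insert i S)) (liar v (insert i S)) (Suc t))"
    by simp
  finally show ?case unfolding w_def .
qed simp

section \<open>Double counting over neighbouring inputs\<close>

text \<open>A form that can be integrated of the alternative: either an element gets more than
  \<open>m\<close> queries, or its likelihood factor \<open>(1/2) ^ q\<close> is at least
  \<open>(1/2) ^ m\<close>.\<close>

lemma Suc_le_add_power_half: "real (Suc m) \<le> real q + 2 ^ m * (1/2) ^ q"
proof (cases "q \<le> m")
  case True
  then obtain d where d: "m = q + d" using le_Suc_ex by blast
  have "real (Suc d) \<le> 2 ^ d"
    using less_exp[of d] by (metis Suc_leI of_nat_le_iff of_nat_numeral of_nat_power)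
  then show ?thesis by (simp add: d power_add power_one_over)
next
  case False
  then have "real (Suc m) \<le> real q" by simp
  then show ?thesis by (simp add: add_increasing2)
qed

text \<open>\<open>Suc_le_add_power_half\<close> is summed over all small elements and integrated
  over the event that \<open>S\<close> is output; \<open>change_of_measure\<close> turns the
  likelihood factors into probabilities on the neighbours. The surplus of \<open>Suc m\<close> over
  \<open>m\<close> leaves the left-hand side.\<close>

lemma prob_neighbours_lower_bound:
  assumes B: "valid_algorithm B" and S: "S \<subseteq> {..<n}"
    and half: "1/2 \<le> measure_pmf.prob (run B (hidden v n S) (liar v S) t) {s. snd s = Some S}"
    and few: "(\<integral>\<^sup>+ s. of_nat (length (fst s)) \<partial>run B (hidden v n S) (liar v S) t)
      \<le> ennreal (real (n - card S) * real m / 2)"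
  shows "real (n - card S) / 2 \<le> 2 ^ m * (\<Sum>i\<in>{..<n} - S. measure_pmf.prob
      (run B (hidden v n (insert i S)) (liar v (insert i S)) t) {s. snd s = Some S})"
proof -
  let ?G = "{s :: config. snd s = Some S}" and ?N = "{..<n} - S"
  let ?M = "measure_pmf (run B (hidden v n S) (liar v S) t)"
  let ?P = "\<lambda>i. measure_pmf.prob (run B (hidden v n (insert i S)) (liar v (insert i S)) t) ?G"
  let ?w = "\<lambda>i s :: config. ennreal ((1/2) ^ length (answers i (fst s)))"
  have card_N: "card ?N = n - card S" using S by (simp add: card_Diff_subset finite_subset)
  have ptw: "of_nat (card ?N * Suc m) * indicator ?G s
      \<le> of_nat (length (fst s)) + ennreal (2 ^ m) * (\<Sum>i\<in>?N. indicator ?G s * ?w i s)" for s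
  proof (cases "s \<in> ?G")
    case True
    have "real (card ?N * Suc m) = (\<Sum>i\<in>?N. real (Suc m))"
      by (simp only: sum_constant of_nat_mult)
    also have "\<dots> \<le> (\<Sum>i\<in>?N. real (length (answers i (fst s)))
        + 2 ^ m * (1/2) ^ length (answers i (fst s)))"
      by (intro sum_mono Suc_le_add_power_half)
    also have "\<dots> = real (\<Sum>i\<in>?N. length (answers i (fst s)))
        + 2 ^ m * (\<Sum>i\<in>?N. (1/2) ^ length (answers i (fst s)))"
      by (simp add: sum.distrib sum_distrib_left)
    also have "\<dots> \<le> real (length (fst s)) + 2 ^ m * (\<Sum>i\<in>?N. (1/2) ^ length (answers i (fst s)))"
      using sum_length_answers_le[of ?N "fst s"] by (intro add_right_mono) (simp only: of_nat_le_iff, simp)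
    finally have "ennreal (real (card ?N * Suc m)) \<le> ennreal (real (length (fst s))
        + 2 ^ m * (\<Sum>i\<in>?N. (1/2) ^ length (answers i (fst s))))"
      by (rule ennreal_leI)
    also have "\<dots> = of_nat (length (fst s)) + ennreal (2 ^ m) * (\<Sum>i\<in>?N. ?w i s)"
      by (simp add: ennreal_plus ennreal_mult sum_nonneg ennreal_of_nat_eq_real_of_nat sum_ennreal
          del: power_one_over)
    finally show ?thesis using True by (simp add: ennreal_of_nat_eq_real_of_nat)
  qed simp
  have "of_nat (card ?N * Suc m) * ennreal (1/2) \<le> of_nat (card ?N * Suc m) * emeasure ?M ?G"
    unfolding measure_pmf.emeasure_eq_measure by (intro mult_left_mono ennreal_leI half) simp
  also have "\<dots> = (\<integral>\<^sup>+ s. of_nat (card ?N * Suc m) * indicator ?G s \<partial>?M)"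
    by (subst nn_integral_cmult) auto
  also have "\<dots> \<le> (\<integral>\<^sup>+ s. of_nat (length (fst s))
      + ennreal (2 ^ m) * (\<Sum>i\<in>?N. indicator ?G s * ?w i s) \<partial>?M)"
    by (intro nn_integral_mono ptw)
  also have "\<dots> = (\<integral>\<^sup>+ s. of_nat (length (fst s)) \<partial>?M)
      + ennreal (2 ^ m) * (\<Sum>i\<in>?N. \<integral>\<^sup>+ s. indicator ?G s * ?w i s \<partial>?M)"
    by (subst nn_integral_add, simp, simp, subst nn_integral_cmult, simp, subst nn_integral_sum) simp_all
  also have "\<dots> \<le> ennreal (real (n - card S) * real m / 2) + ennreal (2 ^ m) * (\<Sum>i\<in>?N. ennreal (?P i))"
  proof (intro add_mono mult_left_mono sum_mono few)
    fix i assume "i \<in> ?N"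
    then have "(\<integral>\<^sup>+ s. indicator ?G s * ?w i s \<partial>?M)
        \<le> (\<integral>\<^sup>+ s. indicator ?G s \<partial>run B (hidden v n (insert i S)) (liar v (insert i S)) t)"
      by (intro change_of_measure B) auto
    then show "(\<integral>\<^sup>+ s. indicator ?G s * ?w i s \<partial>?M) \<le> ennreal (?P i)"
      by (simp add: measure_pmf.emeasure_eq_measure)
  qed simp
  also have "\<dots> = ennreal (real (n - card S) * real m / 2 + 2 ^ m * (\<Sum>i\<in>?N. ?P i))"
    by (simp add: ennreal_plus ennreal_mult sum_nonneg sum_ennreal)
  also have "of_nat (card ?N * Suc m) * ennreal (1/2) = ennreal (real (n - card S) * real (Suc m) / 2)"
    unfolding card_N ennreal_of_nat_eq_real_of_nat
    by (subst ennreal_mult[symmetric]) (simp_all only: of_nat_mult, simp_all)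
  finally have "real (n - card S) * real (Suc m) / 2
      \<le> real (n - card S) * real m / 2 + 2 ^ m * (\<Sum>i\<in>?N. ?P i)"
    by (subst (asm) ennreal_le_iff) (auto intro!: add_nonneg_nonneg mult_nonneg_nonneg sum_nonneg)
  then show ?thesis by (simp add: algebra_simps)
qed

lemma prob_output_mono:
  "measure_pmf.prob (run A xs adv t) {s. snd s = Some S}
    \<le> measure_pmf.prob (run A xs adv (Suc t)) {s. snd s = Some S}"
proof -
  let ?G = "{s :: config. snd s = Some S}"
  have "indicator ?G c \<le> (\<integral>\<^sup>+ s. indicator ?G s \<partial>step A xs adv c)" for c :: config
    by (cases c; cases "snd c") (auto simp: step_def indicator_def)
  then have "(\<integral>\<^sup>+ c. indicator ?G c \<partial>run A xs adv t)
      \<le> (\<integral>\<^sup>+ c. \<integral>\<^sup>+ s. indicator ?G s \<partial>step A xs adv c \<partial>run A xs adv t)"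
    by (intro nn_integral_mono)
  also have "\<dots> = (\<integral>\<^sup>+ s. indicator ?G s \<partial>run A xs adv (Suc t))"
    by (simp only: run.simps nn_integral_bind_pmf)
  finally show ?thesis by (simp add: measure_pmf.emeasure_eq_measure del: run.simps)
qed

text \<open>The supremum need not be attained, so \<open>2/3\<close> is relaxed to
  \<open>1/2\<close>; monotonicity in \<open>t\<close> permits a common \<open>t\<close> for
  finitely many inputs.\<close>

lemma eventually_prob_correct:
  assumes "correct_on v B xs"
  shows "eventually (\<lambda>t. 1/2 \<le> measure_pmf.prob (run B xs adv t)
    {s. snd s = Some (threshold_set v xs)}) sequentially"
proof -
  let ?p = "\<lambda>t. measure_pmf.prob (run B xs adv t) {s. snd s = Some (threshold_set v xs)}"
  have bdd: "bdd_above (range ?p)" by (intro bdd_aboveI[of _ 1]) auto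
  have "1/2 < (SUP t. ?p t)"
    by (rule less_le_trans[of _ "2/3"])
      (use assms in \<open>auto simp: correct_on_def success_prob_def\<close>)
  then obtain t0 where t0: "1/2 < ?p t0" using bdd by (subst (asm) less_cSUP_iff) auto
  have "incseq ?p" by (intro incseq_SucI prob_output_mono)
  then have "?p t0 \<le> ?p t" if "t0 \<le> t" for t using that by (auto dest: incseqD)
  then show ?thesis using t0 unfolding eventually_sequentially by (meson less_imp_le order_trans)
qed

lemma sum_prob_output_le:
  assumes "finite T"
  shows "(\<Sum>i\<in>T. measure_pmf.prob (M :: config pmf) {s. snd s = Some (T - {i})}) \<le> 1"
proof -
  have "(\<Sum>i\<in>T. measure_pmf.prob M {s. snd s = Some (T - {i})})
      = measure_pmf.prob M (\<Union>i\<in>T. {s. snd s = Some (T - {i})})"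
    using assms by (intro measure_pmf.finite_measure_finite_Union[symmetric])
      (auto simp: disjoint_family_on_def)
  then show ?thesis by simp
qed

text \<open>If every \<open>S\<close> of size \<open>k\<close> were cheap, each would be output on
  its neighbours with total probability at least \<open>real (n - k) / 2 ^ Suc m\<close>. Each
  \<open>T\<close> of size \<open>Suc k\<close> supplies at most 1, and there are too few such
  \<open>T\<close>, as \<open>Suc k > 2 ^ Suc m\<close>.\<close>

lemma exists_expensive_hidden_input:
  assumes B: "valid_algorithm B" and correct: "\<And>S. correct_on v B (hidden v n S)"
    and k: "k < n" "2 ^ Suc m \<le> k"
  shows "\<exists>S\<subseteq>{..<n}. card S = k \<and>
    ennreal (real (n - k) * real m / 2) < query_complexity B (hidden v n S)"
proof (rule ccontr)
  assume "\<not> ?thesis"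
  then have cheap: "query_complexity B (hidden v n S) \<le> ennreal (real (n - k) * real m / 2)"
    if "S \<subseteq> {..<n}" "card S = k" for S using that by (metis not_less)
  define F where "F l = {S. S \<subseteq> {..<n} \<and> card S = l}" for l
  have fin: "finite (F l)" for l unfolding F_def by simp
  have card_F: "card (F l) = n choose l" for l unfolding F_def using n_subsets[of "{..<n}" l] by simp
  have "eventually (\<lambda>t. \<forall>S\<in>F k. 1/2 \<le> measure_pmf.prob (run B (hidden v n S) (liar v S) t)
      {s. snd s = Some S}) sequentially"
  proof (intro eventually_ball_finite fin ballI)
    fix S assume "S \<in> F k"
    then have "threshold_set v (hidden v n S) = S" by (simp add: F_def threshold_set_hidden)
    then show "eventually (\<lambda>t. 1/2 \<le> measure_pmf.prob (run B (hidden v n S) (liar v S) t)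
        {s. snd s = Some S}) sequentially"
      using eventually_prob_correct[OF correct[of S], of "liar v S"] by simp
  qed
  then obtain t where half: "\<And>S. S \<in> F k \<Longrightarrow>
      1/2 \<le> measure_pmf.prob (run B (hidden v n S) (liar v S) t) {s. snd s = Some S}"
    using eventually_happens'[OF sequentially_bot] by blast
  let ?p = "\<lambda>T S. measure_pmf.prob (run B (hidden v n T) (liar v T) t) {s. snd s = Some S}"
  have "real (n - k) / 2 \<le> 2 ^ m * (\<Sum>i\<in>{..<n} - S. ?p (insert i S) S)" if S: "S \<in> F k" for S
  proof -
    have "(\<integral>\<^sup>+ s. of_nat (length (fst s)) \<partial>run B (hidden v n S) (liar v S) t)
        \<le> query_complexity B (hidden v n S)"
      unfolding query_complexity_def expected_queries_def
      by (intro SUP_upper2[of "liar v S"] SUP_upper2[of t]) auto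
    also have "\<dots> \<le> ennreal (real (n - k) * real m / 2)" using cheap S by (auto simp: F_def)
    finally show ?thesis
      using prob_neighbours_lower_bound[OF B _ half[OF S], of m] S by (auto simp: F_def)
  qed
  then have "(\<Sum>S\<in>F k. real (n - k) / 2)
      \<le> (\<Sum>S\<in>F k. 2 ^ m * (\<Sum>i\<in>{..<n} - S. ?p (insert i S) S))"
    by (intro sum_mono)
  also have "\<dots> = 2 ^ m * (\<Sum>(S, i)\<in>Sigma (F k) (\<lambda>S. {..<n} - S). ?p (insert i S) S)"
    unfolding sum_distrib_left[symmetric] using fin by (subst sum.Sigma) auto
  \<comment> \<open>The pairs are regrouped by the larger set \<open>T\<close>, with
    \<open>S = T - {i}\<close>.\<close>
  also have "(\<Sum>(S, i)\<in>Sigma (F k) (\<lambda>S. {..<n} - S). ?p (insert i S) S)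
      = (\<Sum>(T, i)\<in>Sigma (F (Suc k)) (\<lambda>T. T). ?p T (T - {i}))"
    by (rule sum.reindex_bij_witness[where i = "\<lambda>(T, i). (T - {i}, i)" and j = "\<lambda>(S, i). (insert i S, i)"])
      (auto simp: F_def insert_absorb finite_subset[of _ "{..<n}"])
  also have "\<dots> = (\<Sum>T\<in>F (Suc k). \<Sum>i\<in>T. ?p T (T - {i}))"
    using fin by (intro sum.Sigma[symmetric]) (auto simp: F_def intro: finite_subset[of _ "{..<n}"])
  also have "2 ^ m * \<dots> \<le> 2 ^ m * (\<Sum>T\<in>F (Suc k). 1)"
    by (intro mult_left_mono sum_mono sum_prob_output_le)
      (auto simp: F_def intro: finite_subset[of _ "{..<n}"])
  finally have "real (n choose k) * real (n - k) \<le> 2 ^ Suc m * real (n choose Suc k)"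
    by (simp add: card_F)
  also have "\<dots> \<le> real k * real (n choose Suc k)"
  proof (rule mult_right_mono)
    show "2 ^ Suc m \<le> real k" using k(2) by (metis of_nat_le_iff of_nat_numeral of_nat_power)
  qed simp
  \<comment> \<open>Strict because \<open>k < n\<close> makes the binomial coefficient
    positive.\<close>
  also have "\<dots> < real (Suc k) * real (n choose Suc k)" using k(1) by simp
  also have "\<dots> = real (n choose k) * real (n - k)"
  proof -
    have "Suc k * (n choose Suc k) = (n choose k) * (n - k)"
      by (simp only: binomial_absorption binomial_absorb_comp mult.commute[of "n choose k"])
    then show ?thesis by (metis of_nat_mult)
  qed
  finally show False by simp
qed

section \<open>Choice of parameters and contradiction\<close>

lemma card_threshold_set_perm:
  assumes "mset xs = mset ys"
  shows "card (threshold_set v xs) = card (threshold_set v ys)"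
proof -
  have "card (threshold_set v zs) = size (filter_mset (\<lambda>x. v \<le> x) (mset zs))" for zs
    unfolding threshold_set_def by (simp add: length_filter_conv_card flip: mset_filter)
  then show ?thesis using assms by simp
qed

theorem mainTheorem7:
  fixes v c :: real
  assumes "0 < c" and "c \<le> 1"
  shows "\<not> (\<exists>B. instance_optimal v (many_distinct_values c) B)"
proof
  assume "\<exists>B. instance_optimal v (many_distinct_values c) B"
  then obtain B C where B: "valid_algorithm B"
    and correct: "\<And>xs. xs \<in> many_distinct_values c \<Longrightarrow> correct_on v B xs"
    and opt: "\<And>xs. xs \<in> many_distinct_values c \<Longrightarrow>
      query_complexity B xs \<le> ennreal C * instance_complexity v xs"
    unfolding instance_optimal_def by blast
  obtain N :: nat where N: "C \<le> real N" "1 \<le> N"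
    using real_arch_simple[of "max C 1"] by auto
  \<comment> \<open>\<open>p\<close> depends on \<open>N\<close> only. The bound on
    \<open>(8/9) ^ p\<close> makes examinations caused by wrong first claims cheap, and
    \<open>32 * N * p \<le> m\<close> does so for the first claims themselves.\<close>
  obtain p where p: "(8/9 :: real) ^ p < 1 / (3072 * real N)"
    using real_arch_pow_inv[of "1 / (3072 * real N)" "8/9"] N by auto
  define m where "m = 32 * N * p + 1536 * N"
  \<comment> \<open>The least \<open>k\<close> that the lower bound admits for \<open>m\<close>.
    With \<open>n = k\<^sup>2\<close>, examinations of length of order \<open>m\<close> suffice,
    while the \<open>k\<close> large elements are few against \<open>n\<close>.\<close>
  define k :: nat where "k = 2 ^ Suc m"
  define n where "n = k\<^sup>2"
  have m: "32 * N * p \<le> m" "1536 * N \<le> m" "1 \<le> m" using N by (auto simp: m_def)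
  have k: "m < k" "1536 * N \<le> k"
    using less_exp[of "Suc m"] m unfolding k_def by linarith+
  have kn: "2 * k \<le> n" "k < n" using k N unfolding n_def power2_eq_square by auto
  \<comment> \<open>Screening has to be correct on inputs of all lengths, so \<open>P\<close> is
    needed at each length; only its value at \<open>n\<close> affects the cost on
    \<open>J\<close>.\<close>
  have "\<exists>q. p < q \<and> real n' * (8/9) ^ q \<le> 1/9" for n'
  proof -
    obtain q where "(8/9 :: real) ^ q < 1 / (9 * (real n' + 1))"
      using real_arch_pow_inv[of "1 / (9 * (real n' + 1))" "8/9"] by auto
    moreover have "(8/9 :: real) ^ (q + Suc p) \<le> (8/9) ^ q" by (intro power_decreasing) auto
    ultimately have "real n' * (8/9) ^ (q + Suc p) \<le> real n' * (1 / (9 * (real n' + 1)))"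
      by (intro mult_left_mono) auto
    also have "\<dots> \<le> 1/9" by (simp add: field_simps)
    finally show ?thesis by (intro exI[of _ "q + Suc p"]) auto
  qed
  then obtain P0 where P0: "\<And>n'. p < P0 n' \<and> real n' * (8/9) ^ P0 n' \<le> 1/9" by metis
  \<comment> \<open>\<open>(8/9) ^ 24 \<le> 1/16\<close> and \<open>16 ^ Suc m = n * n\<close>, so
    an examination at length \<open>n\<close> fails with probability at most
    \<open>1 / (n * n)\<close>.\<close>
  define P where "P = P0(n := 24 * Suc m)"
  have tail: "real n * (8/9) ^ P n \<le> 1 / real n"
  proof -
    have "(8/9 :: real) ^ P n = ((8/9) ^ 24) ^ Suc m" by (simp only: P_def fun_upd_same power_mult)
    also have "\<dots> \<le> (1/16) ^ Suc m" by (intro power_mono) (simp_all add: power_divide)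
    also have "\<dots> = 1 / (real n * real n)"
    proof -
      have "real n * real n = (2 ^ 4) ^ Suc m"
        unfolding n_def k_def by (simp only: power2_eq_square of_nat_mult of_nat_power of_nat_numeral
          power_mult_distrib[symmetric]) (simp del: power_Suc)
      then show ?thesis by (simp add: power_one_over del: power_Suc)
    qed
    finally have "real n * (8/9) ^ P n \<le> real n * (1 / (real n * real n))"
      by (intro mult_left_mono) auto
    then show ?thesis by (simp split: if_splits)
  qed
  have n9: "9 \<le> real n" using kn k N by linarith
  obtain S where S: "S \<subseteq> {..<n}" "card S = k"
    and large: "ennreal (real (n - k) * real m / 2) < query_complexity B (hidden v n S)"
    using exists_expensive_hidden_input[OF B, of v n k m] correct
      hidden_in_many_distinct_values[OF assms(2)] kn by (auto simp: k_def)
  \<comment> \<open>The competitor of \<open>B\<close> is built from the values of the very input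
    that is expensive for \<open>B\<close>.\<close>
  define J where "J = hidden v n S"
  interpret screening v J p P
  proof
    show "distinct J" unfolding J_def by (rule distinct_hidden)
    show "p < P n'" for n'
    proof (cases "n' = n")
      case True
      have "p \<le> 32 * N * p" using N by simp
      then have "p \<le> m" using m(1) by (rule order_trans)
      then show ?thesis using True by (simp add: P_def)
    qed (use P0 in \<open>simp add: P_def\<close>)
    have tail': "real n' * (8/9) ^ P n' \<le> 1/9" for n'
    proof (cases "n' = n")
      case True
      have "1 / real n \<le> 1/9" using n9 by (simp add: field_simps)
      then show ?thesis unfolding True using tail by linarith
    qed (use P0 in \<open>simp add: P_def\<close>)
    have "1 / (3072 * real N) \<le> 1/9" using N by (simp add: field_simps)
    then show "2 * (8/9) ^ p + real n' * (8/9) ^ P n' \<le> 1/3" for n'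
      using p tail'[of n'] by linarith
  qed
  define U where "U = 2 * real p * real n
    + 2 * real (P n) * (2 * (real n * (8/9) ^ p) + real k + real n * (real n * (8/9) ^ P n))"
  have U0: "0 \<le> U" by (simp add: U_def)
  have lenJ: "n = length J" by (simp add: J_def)
  have "instance_complexity v J \<le> (SUP I \<in> {I. mset I = mset J}. query_complexity screen I)"
    unfolding instance_complexity_def by (rule INF_lower[OF screen_in_correct_algorithms])
  also have "\<dots> \<le> ennreal U"
  proof (rule SUP_least)
    fix I assume "I \<in> {I. mset I = mset J}"
    then have perm: "mset I = mset J" by simp
    have "k = card (threshold_set v I)"
      using card_threshold_set_perm[OF perm] S by (simp add: J_def threshold_set_hidden)
    then show "query_complexity screen I \<le> ennreal U"
      unfolding U_def by (rule query_complexity_screen_le[OF perm lenJ])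
  qed
  finally have "ennreal C * instance_complexity v J \<le> ennreal (real N) * ennreal U"
    using N by (intro mult_mono ennreal_leI) auto
  also have "\<dots> = ennreal (real N * U)" using U0 by (simp add: ennreal_mult)
  also have "real N * U \<le> real (n - k) * real m / 2"
  \<comment> \<open>After multiplication by \<open>N\<close>, first claims and examinations due to
    wrong ones take at most \<open>m * n / 16\<close> each, large elements and failed examinations
    together \<open>m * n / 8\<close>. The sum \<open>m * n / 4\<close> fits because
    \<open>2 * k \<le> n\<close>.\<close>
  proof -
    have nk: "real n = real k * real k" by (simp add: n_def power2_eq_square)
    have "real n * (real n * (8/9) ^ P n) \<le> real n * (1 / real n)"
      using tail by (intro mult_left_mono) auto
    also have "\<dots> \<le> real k" using k by (simp add: divide_simps)
    finally have t: "real n * (real n * (8/9) ^ P n) \<le> real k" .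
    have x: "real N * (8/9) ^ p \<le> 1 / 3072" using p N by (simp add: field_simps)
    have a: "real N * (2 * real p * real n) \<le> real m * real n / 16"
    proof -
      have "real (32 * N * p) * real n \<le> real m * real n"
        using m(1) by (intro mult_right_mono) (simp_all only: of_nat_le_iff of_nat_0_le_iff)
      then show ?thesis by simp
    qed
    have Pn: "2 * real (P n) \<le> 96 * real m" using m by (simp add: P_def)
    have b: "real N * (96 * real m * (2 * (real n * (8/9) ^ p))) \<le> real m * real n / 16"
    proof -
      have "192 * real m * real n * (real N * (8/9) ^ p) \<le> 192 * real m * real n * (1 / 3072)"
        using x by (intro mult_left_mono) auto
      then show ?thesis by (simp add: algebra_simps)
    qed
    have d: "real N * (96 * real m * (2 * real k)) \<le> real m * real n / 8"
    proof -
      have "real (1536 * N) * (real m * real k) \<le> real k * (real m * real k)"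
        using k(2) by (intro mult_right_mono) (simp_all only: of_nat_le_iff, simp)
      then show ?thesis by (simp add: nk algebra_simps)
    qed
    have "U \<le> 2 * real p * real n + 96 * real m * (2 * (real n * (8/9) ^ p) + 2 * real k)"
      unfolding U_def by (intro add_left_mono mult_mono[OF Pn]) (use t in auto)
    then have "real N * U \<le> real N * (2 * real p * real n
        + 96 * real m * (2 * (real n * (8/9) ^ p) + 2 * real k))"
      by (intro mult_left_mono) auto
    also have "\<dots> = real N * (2 * real p * real n)
        + real N * (96 * real m * (2 * (real n * (8/9) ^ p))) + real N * (96 * real m * (2 * real k))"
      by (simp add: algebra_simps)
    also have "\<dots> \<le> real m * (real n / 4)" using a b d by simp
    also have "\<dots> \<le> real m * (real (n - k) / 2)"
      using kn by (intro mult_left_mono) (auto simp: of_nat_diff)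
    finally show ?thesis by (simp add: mult.commute)
  qed
  finally have "ennreal C * instance_complexity v J \<le> ennreal (real (n - k) * real m / 2)"
    by (simp add: ennreal_leI)
  moreover have "query_complexity B J \<le> ennreal C * instance_complexity v J"
    unfolding J_def by (intro opt hidden_in_many_distinct_values assms)
  ultimately show False using large unfolding J_def by (meson leD order_trans)
qed

end
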